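(* For any metric space $(\mathcal{M},d)$, every finite simple undirected graph $G$ and every choice of finite nonempty uncertainty sets $\mathcal{U}_i\subseteq\mathcal{M}$, $i\in V[G]$, we have $c^{max}(G)\leq 9\,c(G)$.
   Context: For a graph $G$ with a finite nonempty set $\mathcal{U}_i\subseteq\mathcal{M}$ attached to each vertex $i$, let $\mathcal{U}=\prod_i\mathcal{U}_i$, $c(G)=\max_{u\in\mathcal{U}}\sum_{\{i,j\}\in E[G]}d(u_i,u_j)$, $d^{max}_{ij}=\max_{u_i\in\mathcal{U}_i,u_j\in\mathcal{U}_j}d(u_i,u_j)$ and $c^{max}(G)=\sum_{\{i,j\}\in E[G]}d^{max}_{ij}$. *)

theory Defs
  imports "HOL-Analysis.Analysis" "HOL-Library.Ramsey"
begin

definition finite_simple_graph :: "'v set \<Rightarrow> 'v set set \<Rightarrow> bool" where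
  "finite_simple_graph V E \<longleftrightarrow> finite V \<and> E \<subseteq> nsets V 2"

text \<open>
  The value at an unordered pair \<open>{i, j}\<close> of a function \<open>f\<close> of ordered pairs. It is meaningful
  only if \<open>f i j = f j i\<close>; see \<open>edge_value_doubleton\<close> and the symmetry facts below.
\<close>

definition edge_value :: "('v \<Rightarrow> 'v \<Rightarrow> real) \<Rightarrow> 'v set \<Rightarrow> real" where
  "edge_value f e = (THE r. \<exists>i j. e = {i, j} \<and> r = f i j)"

definition graph_cost ::
  "('m \<Rightarrow> 'm \<Rightarrow> real) \<Rightarrow> 'v set \<Rightarrow> 'v set set \<Rightarrow> ('v \<Rightarrow> 'm set) \<Rightarrow> real" where
  "graph_cost d V E U =
     Max ((\<lambda>u. \<Sum>e\<in>E. edge_value (\<lambda>i j. d (u i) (u j)) e) ` (\<Pi>\<^sub>E i\<in>V. U i))"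

definition dmax ::
  "('m \<Rightarrow> 'm \<Rightarrow> real) \<Rightarrow> ('v \<Rightarrow> 'm set) \<Rightarrow> 'v \<Rightarrow> 'v \<Rightarrow> real" where
  "dmax d U i j = Max ((\<lambda>(x, y). d x y) ` (U i \<times> U j))"

definition graph_cost_max ::
  "('m \<Rightarrow> 'm \<Rightarrow> real) \<Rightarrow> 'v set set \<Rightarrow> ('v \<Rightarrow> 'm set) \<Rightarrow> real" where
  "graph_cost_max d E U = (\<Sum>e\<in>E. edge_value (dmax d U) e)"

lemma edge_value_doubleton:
  assumes "f i j = f j i"
  shows "edge_value f {i, j} = f i j"
  unfolding edge_value_def
proof (rule the_equality)
  show "\<exists>i' j'. {i, j} = {i', j'} \<and> f i j = f i' j'" by blast
  show "\<And>r. \<exists>i' j'. {i, j} = {i', j'} \<and> r = f i' j' \<Longrightarrow> r = f i j"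
    using assms by (auto simp: doubleton_eq_iff)
qed

lemma edge_value_dist:
  assumes "Metric_space M d"
  shows "edge_value (\<lambda>i j. d (u i) (u j)) {i, j} = d (u i) (u j)"
  by (rule edge_value_doubleton) (rule Metric_space.commute[OF assms])

lemma edge_value_dmax:
  assumes "Metric_space M d"
  shows "edge_value (dmax d U) {i, j} = dmax d U i j"
proof (rule edge_value_doubleton)
  have "(\<lambda>(x, y). d x y) ` (U i \<times> U j) = (\<lambda>(x, y). d x y) ` (U j \<times> U i)"
    using Metric_space.commute[OF assms] by (auto simp: image_iff) metis+
  then show "dmax d U i j = dmax d U j i"
    by (simp add: dmax_def)
qed

end

theory Submission
  imports Defs
begin

text \<open>
  Choose in every \<open>U i\<close> a pair \<open>a i\<close>, \<open>b i\<close> at maximal distance \<open>D i\<close> and let \<open>u i\<close> be one of the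
  two, by independent fair coin tosses. Tossing only the coin of \<open>i\<close> again shows that the expected
  length of an edge \<open>{i, j}\<close> is at least \<open>D i / 2\<close>, and likewise \<open>D j / 2\<close>. As
  \<open>dmax i j \<le> D i + d (u i) (u j) + D j\<close>, the expected length is at least \<open>dmax i j / 5\<close>, so
  some choice of \<open>u\<close> shows even \<open>c\<^sup>m\<^sup>a\<^sup>x \<le> 5 c\<close>.
\<close>

text \<open>A set \<open>S\<close> of vertices encodes one outcome of all the coin tosses. Flipping
  at \<open>i\<close> reverses the toss of \<open>i\<close> and leaves every other toss
  alone.\<close>

definition flip :: "'v \<Rightarrow> 'v set \<Rightarrow> 'v set" where
  "flip i S = (if i \<in> S then S - {i} else insert i S)"

text \<open>\<open>flip i\<close> is an involution of \<open>Pow V\<close>, so it only permutes the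
  summands.\<close>

lemma sum_Pow_flip:
  assumes "i \<in> V"
  shows "(\<Sum>S\<in>Pow V. f (flip i S)) = (\<Sum>S\<in>Pow V. f S)"
  by (rule sum.reindex_bij_witness[where i = "flip i" and j = "flip i"])
    (use assms in \<open>auto simp: flip_def split: if_splits\<close>)

text \<open>The restriction to \<open>V\<close> makes the choice extensional, as membership in
  \<open>PiE\<close> requires.\<close>

definition pick :: "'v set \<Rightarrow> ('v \<Rightarrow> 'm) \<Rightarrow> ('v \<Rightarrow> 'm) \<Rightarrow> 'v set \<Rightarrow> 'v \<Rightarrow> 'm" where
  "pick V a b S = (\<lambda>i\<in>V. if i \<in> S then a i else b i)"

lemma finite_diameter_attained:
  fixes d :: "'m \<Rightarrow> 'm \<Rightarrow> real"
  assumes "finite A" "A \<noteq> {}"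
  obtains a b where "a \<in> A" "b \<in> A" "\<And>x y. x \<in> A \<Longrightarrow> y \<in> A \<Longrightarrow> d x y \<le> d a b"
proof -
  let ?D = "(\<lambda>(x, y). d x y) ` (A \<times> A)"
  have D: "finite ?D" "?D \<noteq> {}"
    using assms by auto
  obtain a b where ab: "a \<in> A" "b \<in> A" "Max ?D = d a b"
    using Max_in[OF D] by auto
  moreover have "d x y \<le> d a b" if "x \<in> A" "y \<in> A" for x y
    unfolding ab(3)[symmetric] by (rule Max_ge) (use D that in auto)
  ultimately show thesis
    using that by blast
qed

text \<open>Pair each outcome \<open>S\<close> with \<open>flip i S\<close>. As \<open>j\<close>
  differs from \<open>i\<close>, the point chosen at \<open>j\<close> is the same for both, while
  the points chosen at \<open>i\<close> are \<open>a i\<close> and \<open>b i\<close> in some order.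
  The triangle inequality through the point at \<open>j\<close> bounds \<open>d (a i) (b i)\<close>
  by the two lengths together. Summing over all outcomes counts every length twice, hence the factor
  2.\<close>

lemma (in Metric_space) diameter_le_average_length:
  assumes "i \<in> V" "j \<in> V" "i \<noteq> j"
    and "\<And>k. k \<in> V \<Longrightarrow> a k \<in> M \<and> b k \<in> M"
  shows "real (card (Pow V)) * d (a i) (b i)
    \<le> 2 * (\<Sum>S\<in>Pow V. d (pick V a b S i) (pick V a b S j))"
proof -
  let ?f = "\<lambda>S. d (pick V a b S i) (pick V a b S j)"
  have "d (a i) (b i) \<le> ?f S + ?f (flip i S)" for S
  proof -
    have "d (a i) (b i) \<le> d (a i) (pick V a b S j) + d (b i) (pick V a b S j)"
      using triangle[of "a i" "pick V a b S j" "b i"] assms commute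
      by (auto simp: pick_def)
    then show ?thesis
      using assms(1-3) by (auto simp: pick_def flip_def)
  qed
  then have "(\<Sum>S\<in>Pow V. d (a i) (b i)) \<le> (\<Sum>S\<in>Pow V. ?f S + ?f (flip i S))"
    by (intro sum_mono)
  then show ?thesis
    using sum_Pow_flip[OF assms(1), of ?f] by (simp add: sum.distrib)
qed

lemma (in Metric_space) graph_cost_max_le_5_graph_cost:
  assumes G: "finite_simple_graph V E"
    and U: "\<And>i. i \<in> V \<Longrightarrow> finite (U i) \<and> U i \<noteq> {} \<and> U i \<subseteq> M"
  shows "graph_cost_max d E U \<le> 5 * graph_cost d V E U"
proof -
  have fin: "finite V"
    using G by (simp add: finite_simple_graph_def)
  have "\<exists>a b. a \<in> U i \<and> b \<in> U i \<and> (\<forall>x\<in>U i. \<forall>y\<in>U i. d x y \<le> d a b)" if "i \<in> V" for i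
    using U[OF that] by (metis finite_diameter_attained)
  then obtain a b where ab: "\<And>i. i \<in> V \<Longrightarrow> a i \<in> U i \<and> b i \<in> U i"
    and diam: "\<And>i x y. i \<in> V \<Longrightarrow> x \<in> U i \<Longrightarrow> y \<in> U i \<Longrightarrow> d x y \<le> d (a i) (b i)"
    by metis
  have abM: "a i \<in> M \<and> b i \<in> M" if "i \<in> V" for i
    using ab[OF that] U[OF that] by blast
  define u where "u = pick V a b"
  have uU: "u S i \<in> U i" if "i \<in> V" for S i
    using ab[OF that] that by (simp add: u_def pick_def)
  have uPi: "u S \<in> (\<Pi>\<^sub>E i\<in>V. U i)" for S
    using uU by (auto simp: u_def pick_def)
  \<comment> \<open>\<open>N\<close> counts the equally likely outcomes. Expectations appear below
    as sums over \<open>Pow V\<close>, with the other side multiplied by \<open>N\<close>.\<close>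
  define N where "N = real (card (Pow V))"
  have N: "N > 0"
    using fin by (simp add: N_def card_Pow)
  define cost where "cost = (\<lambda>u. \<Sum>e\<in>E. edge_value (\<lambda>i j. d (u i) (u j)) e)"
  \<comment> \<open>The constant is 5 = 2 + 1 + 2: the diameters at \<open>i\<close> and at
    \<open>j\<close> each cost twice the total length of the edge over all outcomes, and the middle
    leg costs it once.\<close>
  have edge: "N * edge_value (dmax d U) e
      \<le> 5 * (\<Sum>S\<in>Pow V. edge_value (\<lambda>i j. d (u S i) (u S j)) e)" if "e \<in> E" for e
  proof -
    have "e \<in> nsets V 2"
      using that G by (auto simp: finite_simple_graph_def)
    then obtain i j where ij: "e = {i, j}" "i \<in> V" "j \<in> V" "i \<noteq> j"
      by (auto simp: nsets_def card_2_iff)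
    have "dmax d U i j \<in> (\<lambda>(x, y). d x y) ` (U i \<times> U j)"
      unfolding dmax_def by (rule Max_in) (use U ij in auto)
    then obtain x y where xy: "x \<in> U i" "y \<in> U j" "dmax d U i j = d x y"
      by auto
    \<comment> \<open>Walk from \<open>x\<close> to \<open>y\<close> via \<open>u S i\<close> and
      \<open>u S j\<close>. Each outer leg stays within one uncertainty set, so its diameter bounds
      the leg.\<close>
    have "dmax d U i j \<le> d (a i) (b i) + d (u S i) (u S j) + d (a j) (b j)" for S
    proof -
      have inM: "x \<in> M" "y \<in> M" "u S i \<in> M" "u S j \<in> M"
        using xy U ij uU by blast+
      have "d x y \<le> d x (u S i) + d (u S i) y" "d (u S i) y \<le> d (u S i) (u S j) + d (u S j) y"
        using inM triangle by blast+
      moreover have "d x (u S i) \<le> d (a i) (b i)" "d (u S j) y \<le> d (a j) (b j)"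
        using diam uU ij xy by blast+
      ultimately show ?thesis
        using xy by linarith
    qed
    then have "(\<Sum>S\<in>Pow V. dmax d U i j)
        \<le> (\<Sum>S\<in>Pow V. d (a i) (b i) + d (u S i) (u S j) + d (a j) (b j))"
      by (intro sum_mono)
    then have "N * dmax d U i j
        \<le> N * d (a i) (b i) + (\<Sum>S\<in>Pow V. d (u S i) (u S j)) + N * d (a j) (b j)"
      by (simp add: sum.distrib N_def)
    moreover have "N * d (a i) (b i) \<le> 2 * (\<Sum>S\<in>Pow V. d (u S i) (u S j))"
      unfolding N_def u_def using ij abM by (intro diameter_le_average_length) auto
    moreover have "N * d (a j) (b j) \<le> 2 * (\<Sum>S\<in>Pow V. d (u S j) (u S i))"
      unfolding N_def u_def using ij abM by (intro diameter_le_average_length) auto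
    moreover have "(\<Sum>S\<in>Pow V. d (u S j) (u S i)) = (\<Sum>S\<in>Pow V. d (u S i) (u S j))"
      by (simp add: commute)
    ultimately show ?thesis
      by (simp add: ij(1) edge_value_dist[OF Metric_space_axioms]
          edge_value_dmax[OF Metric_space_axioms])
  qed
  \<comment> \<open>Every outcome is an admissible choice, so the maximum bounds each of the costs
    and therefore their average.\<close>
  have "cost (u S) \<le> graph_cost d V E U" for S
    unfolding graph_cost_def cost_def
    by (rule Max_ge) (use uPi U fin in \<open>auto intro!: finite_PiE\<close>)
  then have avg: "(\<Sum>S\<in>Pow V. cost (u S)) \<le> N * graph_cost d V E U"
    unfolding N_def by (intro sum_bounded_above)
  have "N * graph_cost_max d E U
      \<le> (\<Sum>e\<in>E. 5 * (\<Sum>S\<in>Pow V. edge_value (\<lambda>i j. d (u S i) (u S j)) e))"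
    unfolding graph_cost_max_def sum_distrib_left
    by (intro sum_mono) (use edge in \<open>simp add: sum_distrib_left\<close>)
  \<comment> \<open>This is linearity of expectation: the sums over edges and over outcomes are
    exchanged.\<close>
  also have "\<dots> = 5 * (\<Sum>S\<in>Pow V. cost (u S))"
    unfolding cost_def sum_distrib_left[symmetric] by (subst sum.swap) simp
  also have "\<dots> \<le> N * (5 * graph_cost d V E U)"
    using avg by simp
  finally show ?thesis
    using N by simp
qed

text \<open>This allows the factor 5 to be relaxed to 9. The product of the nonempty sets has a
  member, and its cost, a sum of distances, is a lower bound for the maximum.\<close>

lemma (in Metric_space) graph_cost_nonneg:
  assumes G: "finite_simple_graph V E"
    and U: "\<And>i. i \<in> V \<Longrightarrow> finite (U i) \<and> U i \<noteq> {} \<and> U i \<subseteq> M"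
  shows "0 \<le> graph_cost d V E U"
proof -
  obtain u where u: "u \<in> (\<Pi>\<^sub>E i\<in>V. U i)"
    using U by (metis PiE_eq_empty_iff ex_in_conv)
  have "0 \<le> edge_value (\<lambda>i j. d (u i) (u j)) e" if "e \<in> E" for e
  proof -
    have "e \<in> nsets V 2"
      using that G by (auto simp: finite_simple_graph_def)
    then obtain i j where "e = {i, j}"
      by (auto simp: nsets_def card_2_iff)
    then show ?thesis
      by (simp add: edge_value_dist[OF Metric_space_axioms])
  qed
  then have "0 \<le> (\<Sum>e\<in>E. edge_value (\<lambda>i j. d (u i) (u j)) e)"
    by (rule sum_nonneg)
  also have "\<dots> \<le> graph_cost d V E U"
    unfolding graph_cost_def
    by (rule Max_ge) (use u U G in \<open>auto intro!: finite_PiE simp: finite_simple_graph_def\<close>)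
  finally show ?thesis .
qed

theorem theorem4:
  fixes M :: "'m set" and d :: "'m \<Rightarrow> 'm \<Rightarrow> real"
    and V :: "'v set" and E :: "'v set set" and U :: "'v \<Rightarrow> 'm set"
  assumes "Metric_space M d"
    and "finite_simple_graph V E"
    and "\<And>i. i \<in> V \<Longrightarrow> finite (U i) \<and> U i \<noteq> {} \<and> U i \<subseteq> M"
  shows "graph_cost_max d E U \<le> 9 * graph_cost d V E U"
proof -
  have "graph_cost_max d E U \<le> 5 * graph_cost d V E U"
    using assms by (rule Metric_space.graph_cost_max_le_5_graph_cost)
  moreover have "0 \<le> graph_cost d V E U"
    using assms by (rule Metric_space.graph_cost_nonneg)
  ultimately show ?thesis
    by linarith
qed

end
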